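(* Let $S$ be a set. The category of contextful arrows for the state dependently graded comonad $\mathsf{State}_S$ on the category of sets is isomorphic to the Kleisli category of the state monad $X\mapsto(X\times S)^S$.
   Context: **State monad.** The monad on sets with underlying functor $X\mapsto(X\times S)^S$ induced by the adjunction $(-)\times S\dashv(-)^S$: unit $\eta(x)(s)=(x,s)$, and the Kleisli extension of $k:X\to(Y\times S)^S$ sends $\varphi\in(X\times S)^S$ to $s\mapsto k(\mathsf{fst}\,\varphi(s))(\mathsf{snd}\,\varphi(s))$. **Dependently graded comonad with discrete grades.** Such a structure on a category $\mathcal{C}$ consists of: a presheaf of sets (of grades) $\mathcal{M}_{(-)}:\mathcal{C}^{\mathrm{op}}\to\mathrm{Set}$, with reindexing $f^*$; for $M\in\mathcal{M}_C$ an object $C\odot M$, and for $f:C\to C'$, $M'\in\mathcal{M}_{C'}$ a morphism $f\odot M':C\odot f^*M'\to C'\odot M'$, functorially; a grade $I_C\in\mathcal{M}_C$ with $f^*I_{C'}=I_C$; for $M\in\mathcal{M}_C$, $N\in\mathcal{M}_{C\odot M}$ a grade $M\otimes N\in\mathcal{M}_C$ with $f^*(M'\otimes N')=f^*M'\otimes(f\odot M')^*N'$; natural maps $\varepsilon_C:C\odot I_C\to C$, $\delta_{M,N}:C\odot(M\otimes N)\to(C\odot M)\odot N$; such that $I_C\otimes\varepsilon^*M=M$, $M\otimes I_{C\odot M}=M$, $M\otimes(N\otimes L)=(M\otimes N)\otimes\delta^*L$, and $(\varepsilon\odot M)\circ\delta_{I,\varepsilon^*M}=\mathrm{id}$, $\varepsilon\circ\delta_{M,I}=\mathrm{id}$,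 $\delta_{N,L}\circ\delta_{M,N\otimes L}=(\delta_{M,N}\odot L)\circ\delta_{M\otimes N,\delta^*L}$. **Category of contextful arrows.** Objects are those of $\mathcal{C}$; morphisms $A\to B$ are pairs $(P,f)$ with $P\in\mathcal{M}_A$, $f:A\odot P\to B$; identities are $(I_A,\varepsilon_A)$; the composite of $(P,f):A\to B$ followed by $(Q,g):B\to C$ is $(P\otimes f^*Q,\ g\circ(f\odot Q)\circ\delta_{P,f^*Q})$. **$\mathsf{State}_S$** on sets: the grades over $X$ are functions $f:X\times S\to S$, contravariant in $X$ by precomposition ($h^*f=f\circ(h\times S)$); $X\odot f:=X\times S$ (and $h\odot f:=h\times S$); $I_X:=\mathsf{snd}:X\times S\to S$; for $f:X\times S\to S$ and $g:(X\times S)\times S\to S$, $(f\otimes g)(x,s):=g((x,s),f(x,s))$; $\varepsilon_X:=\mathsf{fst}:X\times S\to X$; $\delta_{f,g}(x,s):=((x,s),f(x,s))$. *)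

theory Defs
  imports "HOL-Library.FuncSet"
begin

section \<open>Categories\<close>

text \<open>Hom-sets need not be disjoint, so identities, composites and arrow maps are indexed by
  objects: for \<open>f \<in> Hom C X Y\<close> and \<open>g \<in> Hom C Y Z\<close> the composite \<open>g \<circ> f\<close> is
  \<open>Cmp C X Y Z g f\<close>.\<close>

record ('o, 'a) cat =
  Obj :: "'o set"
  Hom :: "'o \<Rightarrow> 'o \<Rightarrow> 'a set"
  Idt :: "'o \<Rightarrow> 'a"
  Cmp :: "'o \<Rightarrow> 'o \<Rightarrow> 'o \<Rightarrow> 'a \<Rightarrow> 'a \<Rightarrow> 'a"

locale category =
  fixes C :: "('o, 'a) cat"
  assumes ident_hom: "X \<in> Obj C \<Longrightarrow> Idt C X \<in> Hom C X X"
    and comp_hom: "\<lbrakk>X \<in> Obj C; Y \<in> Obj C; Z \<in> Obj C; f \<in> Hom C X Y; g \<in> Hom C Y Z\<rbrakk>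
      \<Longrightarrow> Cmp C X Y Z g f \<in> Hom C X Z"
    and ident_left: "\<lbrakk>X \<in> Obj C; Y \<in> Obj C; f \<in> Hom C X Y\<rbrakk> \<Longrightarrow> Cmp C X Y Y (Idt C Y) f = f"
    and ident_right: "\<lbrakk>X \<in> Obj C; Y \<in> Obj C; f \<in> Hom C X Y\<rbrakk> \<Longrightarrow> Cmp C X X Y f (Idt C X) = f"
    and comp_assoc: "\<lbrakk>W \<in> Obj C; X \<in> Obj C; Y \<in> Obj C; Z \<in> Obj C;
        f \<in> Hom C W X; g \<in> Hom C X Y; h \<in> Hom C Y Z\<rbrakk>
      \<Longrightarrow> Cmp C W X Z (Cmp C X Y Z h g) f = Cmp C W Y Z h (Cmp C W X Y g f)"

locale cat_functor =
  fixes C :: "('o, 'a) cat" and D :: "('p, 'b) cat"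
    and F\<^sub>o :: "'o \<Rightarrow> 'p" and F\<^sub>a :: "'o \<Rightarrow> 'o \<Rightarrow> 'a \<Rightarrow> 'b"
  assumes map_obj: "X \<in> Obj C \<Longrightarrow> F\<^sub>o X \<in> Obj D"
    and map_hom: "\<lbrakk>X \<in> Obj C; Y \<in> Obj C; f \<in> Hom C X Y\<rbrakk> \<Longrightarrow> F\<^sub>a X Y f \<in> Hom D (F\<^sub>o X) (F\<^sub>o Y)"
    and map_ident: "X \<in> Obj C \<Longrightarrow> F\<^sub>a X X (Idt C X) = Idt D (F\<^sub>o X)"
    and map_comp: "\<lbrakk>X \<in> Obj C; Y \<in> Obj C; Z \<in> Obj C; f \<in> Hom C X Y; g \<in> Hom C Y Z\<rbrakk>
      \<Longrightarrow> F\<^sub>a X Z (Cmp C X Y Z g f) = Cmp D (F\<^sub>o X) (F\<^sub>o Y) (F\<^sub>o Z) (F\<^sub>a Y Z g) (F\<^sub>a X Y f)"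

definition isomorphic_categories :: "('o, 'a) cat \<Rightarrow> ('p, 'b) cat \<Rightarrow> bool" where
  "isomorphic_categories C D \<longleftrightarrow> category C \<and> category D \<and>
    (\<exists>F\<^sub>o F\<^sub>a G\<^sub>o G\<^sub>a. cat_functor C D F\<^sub>o F\<^sub>a \<and> cat_functor D C G\<^sub>o G\<^sub>a \<and>
      (\<forall>X\<in>Obj C. G\<^sub>o (F\<^sub>o X) = X) \<and>
      (\<forall>X\<in>Obj C. \<forall>Y\<in>Obj C. \<forall>f\<in>Hom C X Y. G\<^sub>a (F\<^sub>o X) (F\<^sub>o Y) (F\<^sub>a X Y f) = f) \<and>
      (\<forall>X\<in>Obj D. F\<^sub>o (G\<^sub>o X) = X) \<and>
      (\<forall>X\<in>Obj D. \<forall>Y\<in>Obj D. \<forall>f\<in>Hom D X Y. F\<^sub>a (G\<^sub>o X) (G\<^sub>o Y) (G\<^sub>a X Y f) = f))"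


section \<open>Monads and Kleisli categories\<close>

text \<open>\<open>Ext T X Y k\<close> is the Kleisli extension \<open>T X \<rightarrow> T Y\<close> of \<open>k : X \<rightarrow> T Y\<close>.\<close>

record ('o, 'a) monad_data =
  Tobj :: "'o \<Rightarrow> 'o"
  Unit :: "'o \<Rightarrow> 'a"
  Ext :: "'o \<Rightarrow> 'o \<Rightarrow> 'a \<Rightarrow> 'a"

locale monad = category C for C :: "('o, 'a) cat" +
  fixes T :: "('o, 'a) monad_data"
  assumes Tobj_obj: "X \<in> Obj C \<Longrightarrow> Tobj T X \<in> Obj C"
    and unit_hom: "X \<in> Obj C \<Longrightarrow> Unit T X \<in> Hom C X (Tobj T X)"
    and ext_hom: "\<lbrakk>X \<in> Obj C; Y \<in> Obj C; k \<in> Hom C X (Tobj T Y)\<rbrakk>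
      \<Longrightarrow> Ext T X Y k \<in> Hom C (Tobj T X) (Tobj T Y)"
    and ext_unit: "X \<in> Obj C \<Longrightarrow> Ext T X X (Unit T X) = Idt C (Tobj T X)"
    and unit_ext: "\<lbrakk>X \<in> Obj C; Y \<in> Obj C; k \<in> Hom C X (Tobj T Y)\<rbrakk>
      \<Longrightarrow> Cmp C X (Tobj T X) (Tobj T Y) (Ext T X Y k) (Unit T X) = k"
    and ext_ext: "\<lbrakk>X \<in> Obj C; Y \<in> Obj C; Z \<in> Obj C;
        k \<in> Hom C X (Tobj T Y); l \<in> Hom C Y (Tobj T Z)\<rbrakk>
      \<Longrightarrow> Ext T X Z (Cmp C X (Tobj T Y) (Tobj T Z) (Ext T Y Z l) k)
        = Cmp C (Tobj T X) (Tobj T Y) (Tobj T Z) (Ext T Y Z l) (Ext T X Y k)"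

definition kleisli_cat :: "('o, 'a) cat \<Rightarrow> ('o, 'a) monad_data \<Rightarrow> ('o, 'a) cat" where
  "kleisli_cat C T = \<lparr>
    Obj = Obj C,
    Hom = (\<lambda>X Y. Hom C X (Tobj T Y)),
    Idt = (\<lambda>X. Unit T X),
    Cmp = (\<lambda>X Y Z l k. Cmp C X (Tobj T Y) (Tobj T Z) (Ext T Y Z l) k)\<rparr>"


section \<open>Dependently graded comonads with discrete grades\<close>

text \<open>Informal notation, for \<open>f : X \<rightarrow> Y\<close>: \<open>Rei D X Y f N\<close> is \<open>f\<^sup>* N\<close>; \<open>Act D X M\<close> is \<open>X \<odot> M\<close>;
  \<open>ActA D X Y f N\<close> is \<open>f \<odot> N : X \<odot> f\<^sup>* N \<rightarrow> Y \<odot> N\<close>; \<open>Ten D X M N\<close> is \<open>M \<otimes> N\<close> for a grade \<open>M\<close>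
  over \<open>X\<close> and a grade \<open>N\<close> over \<open>X \<odot> M\<close>; \<open>Eps D X\<close> is \<open>\<epsilon>\<close>; \<open>Del D X M N\<close> is \<open>\<delta>\<close>.\<close>

record ('o, 'a, 'm) dgc_data =
  Grd :: "'o \<Rightarrow> 'm set"
  Rei :: "'o \<Rightarrow> 'o \<Rightarrow> 'a \<Rightarrow> 'm \<Rightarrow> 'm"
  Act :: "'o \<Rightarrow> 'm \<Rightarrow> 'o"
  ActA :: "'o \<Rightarrow> 'o \<Rightarrow> 'a \<Rightarrow> 'm \<Rightarrow> 'a"
  IGrd :: "'o \<Rightarrow> 'm"
  Ten :: "'o \<Rightarrow> 'm \<Rightarrow> 'm \<Rightarrow> 'm"
  Eps :: "'o \<Rightarrow> 'a"
  Del :: "'o \<Rightarrow> 'm \<Rightarrow> 'm \<Rightarrow> 'a"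

locale dep_graded_comonad = category C for C :: "('o, 'a) cat" +
  fixes D :: "('o, 'a, 'm) dgc_data"
  assumes rei_grd: "\<lbrakk>X \<in> Obj C; Y \<in> Obj C; f \<in> Hom C X Y; M \<in> Grd D Y\<rbrakk> \<Longrightarrow> Rei D X Y f M \<in> Grd D X"
    and rei_ident: "\<lbrakk>X \<in> Obj C; M \<in> Grd D X\<rbrakk> \<Longrightarrow> Rei D X X (Idt C X) M = M"
    and rei_comp: "\<lbrakk>X \<in> Obj C; Y \<in> Obj C; Z \<in> Obj C; f \<in> Hom C X Y; g \<in> Hom C Y Z; M \<in> Grd D Z\<rbrakk>
      \<Longrightarrow> Rei D X Z (Cmp C X Y Z g f) M = Rei D X Y f (Rei D Y Z g M)"
    and act_obj: "\<lbrakk>X \<in> Obj C; M \<in> Grd D X\<rbrakk> \<Longrightarrow> Act D X M \<in> Obj C"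
    and actA_hom: "\<lbrakk>X \<in> Obj C; Y \<in> Obj C; f \<in> Hom C X Y; M \<in> Grd D Y\<rbrakk>
      \<Longrightarrow> ActA D X Y f M \<in> Hom C (Act D X (Rei D X Y f M)) (Act D Y M)"
    and actA_ident: "\<lbrakk>X \<in> Obj C; M \<in> Grd D X\<rbrakk> \<Longrightarrow> ActA D X X (Idt C X) M = Idt C (Act D X M)"
    and actA_comp: "\<lbrakk>X \<in> Obj C; Y \<in> Obj C; Z \<in> Obj C; f \<in> Hom C X Y; g \<in> Hom C Y Z; M \<in> Grd D Z\<rbrakk>
      \<Longrightarrow> ActA D X Z (Cmp C X Y Z g f) M
        = Cmp C (Act D X (Rei D X Y f (Rei D Y Z g M))) (Act D Y (Rei D Y Z g M)) (Act D Z M)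
            (ActA D Y Z g M) (ActA D X Y f (Rei D Y Z g M))"
    and I_grd: "X \<in> Obj C \<Longrightarrow> IGrd D X \<in> Grd D X"
    and rei_I: "\<lbrakk>X \<in> Obj C; Y \<in> Obj C; f \<in> Hom C X Y\<rbrakk> \<Longrightarrow> Rei D X Y f (IGrd D Y) = IGrd D X"
    and ten_grd: "\<lbrakk>X \<in> Obj C; M \<in> Grd D X; N \<in> Grd D (Act D X M)\<rbrakk> \<Longrightarrow> Ten D X M N \<in> Grd D X"
    and rei_ten: "\<lbrakk>X \<in> Obj C; Y \<in> Obj C; f \<in> Hom C X Y; M \<in> Grd D Y; N \<in> Grd D (Act D Y M)\<rbrakk>
      \<Longrightarrow> Rei D X Y f (Ten D Y M N)
        = Ten D X (Rei D X Y f M)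
            (Rei D (Act D X (Rei D X Y f M)) (Act D Y M) (ActA D X Y f M) N)"
    and eps_hom: "X \<in> Obj C \<Longrightarrow> Eps D X \<in> Hom C (Act D X (IGrd D X)) X"
    and eps_nat: "\<lbrakk>X \<in> Obj C; Y \<in> Obj C; f \<in> Hom C X Y\<rbrakk>
      \<Longrightarrow> Cmp C (Act D X (IGrd D X)) X Y f (Eps D X)
        = Cmp C (Act D X (IGrd D X)) (Act D Y (IGrd D Y)) Y (Eps D Y) (ActA D X Y f (IGrd D Y))"
    and del_hom: "\<lbrakk>X \<in> Obj C; M \<in> Grd D X; N \<in> Grd D (Act D X M)\<rbrakk>
      \<Longrightarrow> Del D X M N \<in> Hom C (Act D X (Ten D X M N)) (Act D (Act D X M) N)"
    and del_nat: "\<lbrakk>X \<in> Obj C; Y \<in> Obj C; f \<in> Hom C X Y; M \<in> Grd D Y; N \<in> Grd D (Act D Y M);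
        M' = Rei D X Y f M; N' = Rei D (Act D X M') (Act D Y M) (ActA D X Y f M) N\<rbrakk>
      \<Longrightarrow> Cmp C (Act D X (Ten D X M' N')) (Act D (Act D X M') N') (Act D (Act D Y M) N)
            (ActA D (Act D X M') (Act D Y M) (ActA D X Y f M) N) (Del D X M' N')
        = Cmp C (Act D X (Ten D X M' N')) (Act D Y (Ten D Y M N)) (Act D (Act D Y M) N)
            (Del D Y M N) (ActA D X Y f (Ten D Y M N))"
    and ten_I_left: "\<lbrakk>X \<in> Obj C; M \<in> Grd D X\<rbrakk>
      \<Longrightarrow> Ten D X (IGrd D X) (Rei D (Act D X (IGrd D X)) X (Eps D X) M) = M"
    and ten_I_right: "\<lbrakk>X \<in> Obj C; M \<in> Grd D X\<rbrakk> \<Longrightarrow> Ten D X M (IGrd D (Act D X M)) = M"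
    and ten_assoc: "\<lbrakk>X \<in> Obj C; M \<in> Grd D X; N \<in> Grd D (Act D X M); L \<in> Grd D (Act D (Act D X M) N)\<rbrakk>
      \<Longrightarrow> Ten D X M (Ten D (Act D X M) N L)
        = Ten D X (Ten D X M N)
            (Rei D (Act D X (Ten D X M N)) (Act D (Act D X M) N) (Del D X M N) L)"
    and del_eps_left: "\<lbrakk>X \<in> Obj C; M \<in> Grd D X; M' = Rei D (Act D X (IGrd D X)) X (Eps D X) M\<rbrakk>
      \<Longrightarrow> Cmp C (Act D X M) (Act D (Act D X (IGrd D X)) M') (Act D X M)
            (ActA D (Act D X (IGrd D X)) X (Eps D X) M) (Del D X (IGrd D X) M')
        = Idt C (Act D X M)"
    and del_eps_right: "\<lbrakk>X \<in> Obj C; M \<in> Grd D X\<rbrakk>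
      \<Longrightarrow> Cmp C (Act D X M) (Act D (Act D X M) (IGrd D (Act D X M))) (Act D X M)
            (Eps D (Act D X M)) (Del D X M (IGrd D (Act D X M)))
        = Idt C (Act D X M)"
    and del_del: "\<lbrakk>X \<in> Obj C; M \<in> Grd D X; N \<in> Grd D (Act D X M); L \<in> Grd D (Act D (Act D X M) N);
        XM = Act D X M; MN = Ten D X M N; NL = Ten D XM N L;
        L' = Rei D (Act D X MN) (Act D XM N) (Del D X M N) L\<rbrakk>
      \<Longrightarrow> Cmp C (Act D X (Ten D X M NL)) (Act D XM NL) (Act D (Act D XM N) L)
            (Del D XM N L) (Del D X M NL)
        = Cmp C (Act D X (Ten D X MN L')) (Act D (Act D X MN) L') (Act D (Act D XM N) L)
            (ActA D (Act D X MN) (Act D XM N) (Del D X M N) L) (Del D X MN L')"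

definition contextful_cat ::
  "('o, 'a) cat \<Rightarrow> ('o, 'a, 'm) dgc_data \<Rightarrow> ('o, 'm \<times> 'a) cat" where
  "contextful_cat C D = \<lparr>
    Obj = Obj C,
    Hom = (\<lambda>X Y. {(P, f). P \<in> Grd D X \<and> f \<in> Hom C (Act D X P) Y}),
    Idt = (\<lambda>X. (IGrd D X, Eps D X)),
    Cmp = (\<lambda>X Y Z (Q, g) (P, f).
      let XP = Act D X P; fQ = Rei D XP Y f Q; R = Ten D X P fQ in
      (R, Cmp C (Act D X R) (Act D Y Q) Z g
            (Cmp C (Act D X R) (Act D XP fQ) (Act D Y Q) (ActA D XP Y f Q) (Del D X P fQ))))\<rparr>"


section \<open>The category of sets\<close>

text \<open>There is no HOL type of all sets, so the category of sets is taken relative to a universe: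
  a collection \<open>Sets U\<close> of subsets of some type \<open>'u\<close>, with \<^emph>\<open>all\<close> functions between them as
  arrows. The only thing required of the universe is that it contains, up to the encodings
  \<open>Pr U\<close> of pairs and \<open>Fn U\<close> of functions, \<open>X \<times> S\<close> and \<open>X\<^sup>S\<close> along with \<open>X\<close>, as is needed for
  the functors \<open>(-) \<times> S\<close> and \<open>(-)\<^sup>S\<close>. The type \<open>'s\<close> of the elements of \<open>S\<close> is arbitrary.\<close>

record ('u, 's) universe =
  Sets :: "'u set set"
  Pr :: "'u \<Rightarrow> 's \<Rightarrow> 'u"
  Fn :: "('s \<Rightarrow> 'u) \<Rightarrow> 'u"

definition prodS :: "('u, 's) universe \<Rightarrow> 's set \<Rightarrow> 'u set \<Rightarrow> 'u set" where
  "prodS U S X = (\<lambda>(x, s). Pr U x s) ` (X \<times> S)"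

definition expS :: "('u, 's) universe \<Rightarrow> 's set \<Rightarrow> 'u set \<Rightarrow> 'u set" where
  "expS U S X = Fn U ` (S \<rightarrow>\<^sub>E X)"

locale state_universe =
  fixes U :: "('u, 's) universe" and S :: "'s set"
  assumes prodS_Sets: "X \<in> Sets U \<Longrightarrow> prodS U S X \<in> Sets U"
    and expS_Sets: "X \<in> Sets U \<Longrightarrow> expS U S X \<in> Sets U"
    and Pr_inj: "X \<in> Sets U \<Longrightarrow> inj_on (\<lambda>(x, s). Pr U x s) (X \<times> S)"
    and Fn_inj: "X \<in> Sets U \<Longrightarrow> inj_on (Fn U) (S \<rightarrow>\<^sub>E X)"

text \<open>Decoding of the elements of \<open>prodS U S X\<close> and \<open>expS U S X\<close>.\<close>

definition unPr :: "('u, 's) universe \<Rightarrow> 's set \<Rightarrow> 'u set \<Rightarrow> 'u \<Rightarrow> 'u \<times> 's" where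
  "unPr U S X = the_inv_into (X \<times> S) (\<lambda>(x, s). Pr U x s)"

definition unFn :: "('u, 's) universe \<Rightarrow> 's set \<Rightarrow> 'u set \<Rightarrow> 'u \<Rightarrow> 's \<Rightarrow> 'u" where
  "unFn U S X = the_inv_into (S \<rightarrow>\<^sub>E X) (Fn U)"

definition set_cat :: "('u, 's) universe \<Rightarrow> ('u set, 'u \<Rightarrow> 'u) cat" where
  "set_cat U = \<lparr>
    Obj = Sets U,
    Hom = (\<lambda>X Y. X \<rightarrow>\<^sub>E Y),
    Idt = (\<lambda>X. \<lambda>x\<in>X. x),
    Cmp = (\<lambda>X Y Z g f. compose X g f)\<rparr>"


section \<open>The state monad\<close>

definition state_monad :: "('u, 's) universe \<Rightarrow> 's set \<Rightarrow> ('u set, 'u \<Rightarrow> 'u) monad_data" where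
  "state_monad U S = \<lparr>
    Tobj = (\<lambda>X. expS U S (prodS U S X)),
    Unit = (\<lambda>X. \<lambda>x\<in>X. Fn U (\<lambda>s\<in>S. Pr U x s)),
    Ext = (\<lambda>X Y k. \<lambda>t\<in>expS U S (prodS U S X). Fn U (\<lambda>s\<in>S.
      let (x, s') = unPr U S X (unFn U S (prodS U S X) t s)
      in unFn U S (prodS U S Y) (k x) s'))\<rparr>"


section \<open>The state dependently graded comonad\<close>

text \<open>A grade over \<open>X\<close> is a function on the plain set \<open>X \<times> S\<close>; the object \<open>X \<odot> f\<close> is its
  encoding \<open>prodS U S X\<close>.\<close>

definition State :: "('u, 's) universe \<Rightarrow> 's set
    \<Rightarrow> ('u set, 'u \<Rightarrow> 'u, 'u \<times> 's \<Rightarrow> 's) dgc_data" where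
  "State U S = \<lparr>
    Grd = (\<lambda>X. X \<times> S \<rightarrow>\<^sub>E S),
    Rei = (\<lambda>X Y h f. \<lambda>(x, s)\<in>X \<times> S. f (h x, s)),
    Act = (\<lambda>X f. prodS U S X),
    ActA = (\<lambda>X Y h f. \<lambda>z\<in>prodS U S X. let (x, s) = unPr U S X z in Pr U (h x) s),
    IGrd = (\<lambda>X. \<lambda>(x, s)\<in>X \<times> S. s),
    Ten = (\<lambda>X f g. \<lambda>(x, s)\<in>X \<times> S. g (Pr U x s, f (x, s))),
    Eps = (\<lambda>X. \<lambda>z\<in>prodS U S X. fst (unPr U S X z)),
    Del = (\<lambda>X f g. \<lambda>z\<in>prodS U S X. let (x, s) = unPr U S X z in Pr U (Pr U x s) (f (x, s)))\<rparr>"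


section \<open>Basic facts\<close>

text \<open>Every type \<open>'a\<close> embeds into a universe in the above sense, so \<open>state_universe\<close> is
  satisfiable for every \<open>S\<close>, with arbitrarily large sets.\<close>

datatype ('a, 's) code = Atom 'a | Pair_code "('a, 's) code" 's | Fun_code "'s \<Rightarrow> ('a, 's) code"

lemma state_universe_code:
  "state_universe \<lparr>Sets = UNIV, Pr = Pair_code, Fn = Fun_code\<rparr> S"
  by unfold_locales (auto simp: inj_on_def)

lemma category_set_cat: "category (set_cat U)"
proof unfold_locales
qed (auto simp: set_cat_def compose_def restrict_def PiE_iff extensional_def fun_eq_iff Pi_iff)

context state_universe
begin

lemma unPr_Pr [simp]: "\<lbrakk>X \<in> Sets U; x \<in> X; s \<in> S\<rbrakk> \<Longrightarrow> unPr U S X (Pr U x s) = (x, s)"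
  unfolding unPr_def using the_inv_into_f_f[OF Pr_inj, of X "(x, s)"] by simp

lemma unFn_Fn [simp]: "\<lbrakk>X \<in> Sets U; \<phi> \<in> S \<rightarrow>\<^sub>E X\<rbrakk> \<Longrightarrow> unFn U S X (Fn U \<phi>) = \<phi>"
  unfolding unFn_def by (rule the_inv_into_f_f[OF Fn_inj])

lemma Pr_prodS [simp]: "\<lbrakk>x \<in> X; s \<in> S\<rbrakk> \<Longrightarrow> Pr U x s \<in> prodS U S X"
  by (auto simp: prodS_def)

lemma prodS_E:
  assumes "z \<in> prodS U S X" obtains x s where "x \<in> X" "s \<in> S" "z = Pr U x s"
  using assms by (auto simp: prodS_def)

lemma prodS_ball [simp]: "(\<forall>z\<in>prodS U S X. P z) \<longleftrightarrow> (\<forall>x\<in>X. \<forall>s\<in>S. P (Pr U x s))"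
  by (auto simp: prodS_def)

lemma prodS_restrict_eq_iff:
  "restrict f (prodS U S X) = restrict g (prodS U S X)
    \<longleftrightarrow> (\<forall>x\<in>X. \<forall>s\<in>S. f (Pr U x s) = g (Pr U x s))"
  by (auto simp: fun_eq_iff restrict_def prodS_def)

lemma restrict_prodS_PiE_iff [simp]:
  "restrict f (prodS U S X) \<in> prodS U S X \<rightarrow>\<^sub>E Y \<longleftrightarrow> (\<forall>x\<in>X. \<forall>s\<in>S. f (Pr U x s) \<in> Y)"
  by (auto simp: PiE_iff prodS_def)

lemma restrict_pair_eq_iff:
  "restrict f (X \<times> S) = g \<longleftrightarrow> g \<in> extensional (X \<times> S) \<and> (\<forall>x\<in>X. \<forall>s\<in>S. f (x, s) = g (x, s))"
  by (auto simp: fun_eq_iff restrict_def extensional_def)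

lemmas State_simps = set_cat_def State_def compose_def prodS_Sets prodS_restrict_eq_iff
  restrict_pair_eq_iff

lemma dep_graded_comonad_State: "dep_graded_comonad (set_cat U) (State U S)"
proof -
  interpret category "set_cat U" by (rule category_set_cat)
  show ?thesis
    by unfold_locales (simp_all add: State_simps PiE_iff)
qed

lemma unPr_prodS [simp]:
  assumes "X \<in> Sets U" "z \<in> prodS U S X"
  shows "fst (unPr U S X z) \<in> X" "snd (unPr U S X z) \<in> S"
    "Pr U (fst (unPr U S X z)) (snd (unPr U S X z)) = z"
  using assms by (auto elim!: prodS_E)

lemma unFn_expS [simp]:
  assumes "X \<in> Sets U" "t \<in> expS U S X"
  shows "s \<in> S \<Longrightarrow> unFn U S X t s \<in> X" "Fn U (restrict (unFn U S X t) S) = t"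
  using assms by (auto simp: expS_def PiE_iff extensional_restrict)

lemma restrict_S_PiE_iff [simp]: "restrict f S \<in> S \<rightarrow>\<^sub>E X \<longleftrightarrow> (\<forall>s\<in>S. f s \<in> X)"
  by (auto simp: PiE_iff)

lemma Fn_expS [simp]: "\<forall>s\<in>S. f s \<in> X \<Longrightarrow> Fn U (restrict f S) \<in> expS U S X"
  by (auto simp: expS_def)

lemma monad_state_monad: "monad (set_cat U) (state_monad U S)"
proof -
  interpret category "set_cat U" by (rule category_set_cat)
  show ?thesis
  proof (unfold_locales, unfold set_cat_def state_monad_def cat.simps monad_data.simps, goal_cases)
    case (1 X)
    then show ?case by (simp add: expS_Sets prodS_Sets)
  next
    case (2 X)
    then show ?case by simp
  next
    case (3 X Y k)
    have "k x \<in> expS U S (prodS U S Y)" if "x \<in> X" for x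
      using 3 that by (blast dest: PiE_mem)
    with 3 show ?case
      by (intro restrict_PiE_iff[THEN iffD2] ballI Fn_expS) (simp add: split_def Let_def prodS_Sets)
  next
    case (4 X)
    have "(\<lambda>s\<in>S. case unPr U S X (unFn U S (prodS U S X) t s) of (x, s') \<Rightarrow>
        unFn U S (prodS U S X) ((\<lambda>x\<in>X. Fn U (\<lambda>s\<in>S. Pr U x s)) x) s')
      = restrict (unFn U S (prodS U S X) t) S" if "t \<in> expS U S (prodS U S X)" for t
      using 4 that by (intro restrict_ext) (simp add: split_def Let_def prodS_Sets)
    with 4 show ?case
      by (intro restrict_ext) (simp add: prodS_Sets)
  next
    case (5 X Y k)
    have k: "k x \<in> expS U S (prodS U S Y)" if "x \<in> X" for x
      using 5 that by (blast dest: PiE_mem)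
    have "(\<lambda>s\<in>S. case unPr U S X (unFn U S (prodS U S X) (Fn U (\<lambda>s\<in>S. Pr U x s)) s) of (x, s') \<Rightarrow>
        unFn U S (prodS U S Y) (k x) s')
      = restrict (unFn U S (prodS U S Y) (k x)) S" if "x \<in> X" for x
      using 5 that by (intro restrict_ext) (simp add: prodS_Sets)
    with 5 k show ?case
      by (intro PiE_ext[where k = X and s = "\<lambda>_. expS U S (prodS U S Y)"])
        (simp_all add: compose_def prodS_Sets)
  next
    case (6 X Y Z k l)
    have k: "k x \<in> expS U S (prodS U S Y)" if "x \<in> X" for x
      using 6 that by (blast dest: PiE_mem)
    have l: "l y \<in> expS U S (prodS U S Z)" if "y \<in> Y" for y
      using 6 that by (blast dest: PiE_mem)
    show ?case
      unfolding compose_def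
    proof (rule restrict_ext, goal_cases)
      case (1 t)
      with 6 k l show ?case
        by (simp add: split_def Let_def prodS_Sets cong: restrict_cong)
    qed
  qed
qed

end

end

theory Submission
  imports Defs
begin

text \<open>A contextful arrow from \<open>X\<close> to \<open>Y\<close> for \<open>State\<^sub>S\<close> is a pair of functions \<open>P : X \<times> S \<rightarrow> S\<close> and
  \<open>f : X \<times> S \<rightarrow> Y\<close>, that is, one function \<open>X \<times> S \<rightarrow> Y \<times> S\<close>; currying turns it into an arrow
  \<open>X \<rightarrow> (Y \<times> S)\<^sup>S\<close> of the Kleisli category. So the two categories have the same objects, and
  currying (\<open>contextful_to_kleisli\<close>) and uncurrying (\<open>kleisli_to_contextful\<close>) are mutually inverse
  bijections between their hom-sets.

  The bijection respects identities because both of them correspond to the identity on \<open>X \<times> S\<close>.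
  For composition, \<open>\<delta>\<close> records the updated state next to the old context, \<open>f \<odot> Q\<close> applies \<open>f\<close>
  to the old context and keeps the updated state, and the grade \<open>P \<otimes> f\<^sup>* Q\<close> is \<open>Q\<close> evaluated at the
  result; hence the contextful composite sends \<open>(x, s)\<close> to the pair of \<open>g (f (x, s), P (x, s))\<close> and
  \<open>Q (f (x, s), P (x, s))\<close>, which is the composite of functions \<open>X \<times> S \<rightarrow> Y \<times> S \<rightarrow> Z \<times> S\<close>. The
  Kleisli composite is this same composite in curried form.

  The category laws hold in every Kleisli category (\<open>category_kleisli_cat\<close>), and the bijection
  carries them back to contextful arrows (\<open>isomorphic_categories_if_hom_bijections\<close>).\<close>

section \<open>Kleisli categories and transport of category laws\<close>

lemma (in monad) category_kleisli_cat: "category (kleisli_cat C T)"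
proof (unfold_locales, unfold kleisli_cat_def cat.simps, goal_cases)
  case (1 X)
  then show ?case by (rule unit_hom)
next
  case (2 X Y Z f g)
  then show ?case by (blast intro: comp_hom ext_hom Tobj_obj)
next
  case (3 X Y f)
  then show ?case by (simp add: ext_unit ident_left Tobj_obj)
next
  case (4 X Y f)
  then show ?case by (simp add: unit_ext)
next
  case (5 W X Y Z f g h)
  then show ?case by (simp add: ext_ext comp_assoc[OF _ Tobj_obj Tobj_obj Tobj_obj _ ext_hom ext_hom])
qed

text \<open>Category laws are equations between arrows, so a structure that maps injectively and
  compatibly with identities and composites into a category satisfies them as soon as its
  identities and composites are well-typed. The inverse of such a map, where it exists, is then
  functorial for the same reason.\<close>

lemma isomorphic_categories_if_hom_bijections:
  fixes C :: "('o, 'a) cat" and D :: "('o, 'b) cat"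
  assumes D: "category D"
    and Obj: "Obj C = Obj D"
    and ident: "\<And>X. X \<in> Obj D \<Longrightarrow> Idt C X \<in> Hom C X X"
    and comp: "\<And>X Y Z f g. \<lbrakk>X \<in> Obj D; Y \<in> Obj D; Z \<in> Obj D; f \<in> Hom C X Y; g \<in> Hom C Y Z\<rbrakk>
      \<Longrightarrow> Cmp C X Y Z g f \<in> Hom C X Z"
    and F: "\<And>X Y f. \<lbrakk>X \<in> Obj D; Y \<in> Obj D; f \<in> Hom C X Y\<rbrakk> \<Longrightarrow> F X Y f \<in> Hom D X Y"
    and G: "\<And>X Y k. \<lbrakk>X \<in> Obj D; Y \<in> Obj D; k \<in> Hom D X Y\<rbrakk> \<Longrightarrow> G X Y k \<in> Hom C X Y"
    and GF: "\<And>X Y f. \<lbrakk>X \<in> Obj D; Y \<in> Obj D; f \<in> Hom C X Y\<rbrakk> \<Longrightarrow> G X Y (F X Y f) = f"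
    and FG: "\<And>X Y k. \<lbrakk>X \<in> Obj D; Y \<in> Obj D; k \<in> Hom D X Y\<rbrakk> \<Longrightarrow> F X Y (G X Y k) = k"
    and F_ident: "\<And>X. X \<in> Obj D \<Longrightarrow> F X X (Idt C X) = Idt D X"
    and F_comp: "\<And>X Y Z f g. \<lbrakk>X \<in> Obj D; Y \<in> Obj D; Z \<in> Obj D; f \<in> Hom C X Y; g \<in> Hom C Y Z\<rbrakk>
      \<Longrightarrow> F X Z (Cmp C X Y Z g f) = Cmp D X Y Z (F Y Z g) (F X Y f)"
  shows "isomorphic_categories C D"
proof -
  interpret D: category D by (rule D)
  have eqI: "f = g" if "X \<in> Obj D" "Y \<in> Obj D" "f \<in> Hom C X Y" "g \<in> Hom C X Y" "F X Y f = F X Y g"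
    for X Y f g
    using that GF by metis
  have "category C"
  proof (unfold_locales, unfold Obj, goal_cases)
    case (1 X)
    then show ?case by (rule ident)
  next
    case (2 X Y Z f g)
    then show ?case by (rule comp)
  next
    case (3 X Y f)
    then show ?case by (intro eqI[of X Y]) (simp_all add: ident comp F F_ident F_comp D.ident_left)
  next
    case (4 X Y f)
    then show ?case by (intro eqI[of X Y]) (simp_all add: ident comp F F_ident F_comp D.ident_right)
  next
    case (5 W X Y Z f g h)
    then have "Cmp C X Y Z h g \<in> Hom C X Z" "Cmp C W X Y g f \<in> Hom C W Y"
      by (blast intro: comp)+
    with 5 show ?case
      by (intro eqI[of W Z]) (auto intro: comp simp: F F_comp D.comp_assoc)
  qed
  moreover have "cat_functor C D (\<lambda>X. X) F"
    by unfold_locales (simp_all add: Obj F F_ident F_comp)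
  moreover have "cat_functor D C (\<lambda>X. X) G"
  proof (unfold_locales, goal_cases)
    case (4 X Y Z k l)
    have "F X Z (Cmp C X Y Z (G Y Z l) (G X Y k)) = Cmp D X Y Z l k"
      using 4 by (simp add: F_comp G FG)
    moreover have "Cmp C X Y Z (G Y Z l) (G X Y k) \<in> Hom C X Z"
      using 4 by (blast intro: comp G)
    ultimately show ?case using 4 GF by metis
  next
    case (3 X)
    then show ?case using GF[of X X "Idt C X"] by (simp add: ident F_ident)
  qed (simp_all add: Obj G)
  ultimately show ?thesis
    unfolding isomorphic_categories_def using D Obj GF FG by blast
qed

section \<open>Currying contextful arrows\<close>

definition contextful_to_kleisli :: "('u, 's) universe \<Rightarrow> 's set \<Rightarrow> 'u set
    \<Rightarrow> ('u \<times> 's \<Rightarrow> 's) \<times> ('u \<Rightarrow> 'u) \<Rightarrow> 'u \<Rightarrow> 'u" where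
  "contextful_to_kleisli U S X = (\<lambda>(P, f). \<lambda>x\<in>X. Fn U (\<lambda>s\<in>S. Pr U (f (Pr U x s)) (P (x, s))))"

definition kleisli_to_contextful :: "('u, 's) universe \<Rightarrow> 's set \<Rightarrow> 'u set \<Rightarrow> 'u set
    \<Rightarrow> ('u \<Rightarrow> 'u) \<Rightarrow> ('u \<times> 's \<Rightarrow> 's) \<times> ('u \<Rightarrow> 'u)" where
  "kleisli_to_contextful U S X Y k =
    (\<lambda>(x, s)\<in>X \<times> S. snd (unPr U S Y (unFn U S (prodS U S Y) (k x) s)),
     \<lambda>z\<in>prodS U S X. let (x, s) = unPr U S X z
       in fst (unPr U S Y (unFn U S (prodS U S Y) (k x) s)))"

context state_universe
begin

abbreviation "contextful_State \<equiv> contextful_cat (set_cat U) (State U S)"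
abbreviation "kleisli_state \<equiv> kleisli_cat (set_cat U) (state_monad U S)"

lemma Obj_contextful_State: "Obj contextful_State = Sets U"
  by (simp add: contextful_cat_def set_cat_def)

lemma Obj_kleisli_state: "Obj kleisli_state = Sets U"
  by (simp add: kleisli_cat_def set_cat_def)

lemma Hom_contextful_State:
  "Hom contextful_State X Y = {(P, f). P \<in> X \<times> S \<rightarrow>\<^sub>E S \<and> f \<in> prodS U S X \<rightarrow>\<^sub>E Y}"
  by (simp add: contextful_cat_def set_cat_def State_def)

lemma Hom_kleisli_state: "Hom kleisli_state X Y = X \<rightarrow>\<^sub>E expS U S (prodS U S Y)"
  by (simp add: kleisli_cat_def set_cat_def state_monad_def)

lemma Idt_contextful_State:
  "Idt contextful_State X = (\<lambda>(x, s)\<in>X \<times> S. s, \<lambda>z\<in>prodS U S X. fst (unPr U S X z))"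
  by (simp add: contextful_cat_def State_def)

lemma Idt_kleisli_state: "Idt kleisli_state X = (\<lambda>x\<in>X. Fn U (\<lambda>s\<in>S. Pr U x s))"
  by (simp add: kleisli_cat_def state_monad_def)

lemma contextful_homD:
  assumes "(P, f) \<in> Hom contextful_State X Y" "x \<in> X" "s \<in> S"
  shows "P (x, s) \<in> S" "f (Pr U x s) \<in> Y"
  using assms by (auto simp: Hom_contextful_State)

text \<open>Evaluating \<open>\<delta>\<close>, \<open>f \<odot> Q\<close> and the tensor of grades leaves the composite of functions
  \<open>X \<times> S \<rightarrow> Y \<times> S \<rightarrow> Z \<times> S\<close>, split into its two components; in this form it can be compared
  with the Kleisli composite.\<close>

lemma Cmp_contextful_State:
  assumes X: "X \<in> Sets U" and Pf: "(P, f) \<in> Hom contextful_State X Y"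
  shows "Cmp contextful_State X Y Z (Q, g) (P, f) =
    (\<lambda>(x, s)\<in>X \<times> S. Q (f (Pr U x s), P (x, s)),
     \<lambda>z\<in>prodS U S X. case unPr U S X z of (x, s) \<Rightarrow> g (Pr U (f (Pr U x s)) (P (x, s))))"
  using X contextful_homD[OF Pf]
  by (simp add: contextful_cat_def State_simps Let_def)

lemma Cmp_kleisli_state:
  "Cmp kleisli_state X Y Z l k = (\<lambda>x\<in>X. Ext (state_monad U S) Y Z l (k x))"
  by (simp add: kleisli_cat_def set_cat_def compose_def)

lemma contextful_to_kleisli_hom:
  assumes "Pf \<in> Hom contextful_State X Y"
  shows "contextful_to_kleisli U S X Pf \<in> Hom kleisli_state X Y"
  using assms by (cases Pf)
    (auto simp: Hom_kleisli_state contextful_to_kleisli_def contextful_homD intro!: Fn_expS)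

lemma kleisli_to_contextful_hom:
  assumes X: "X \<in> Sets U" and Y: "Y \<in> Sets U" and k: "k \<in> Hom kleisli_state X Y"
  shows "kleisli_to_contextful U S X Y k \<in> Hom contextful_State X Y"
proof -
  have "unFn U S (prodS U S Y) (k x) s \<in> prodS U S Y" if "x \<in> X" "s \<in> S" for x s
    using that k Y by (intro unFn_expS(1)) (auto simp: Hom_kleisli_state prodS_Sets)
  with X Y show ?thesis
    by (auto simp: Hom_contextful_State kleisli_to_contextful_def elim!: prodS_E)
qed

lemma kleisli_to_contextful_to_kleisli:
  assumes X: "X \<in> Sets U" and Y: "Y \<in> Sets U" and k: "k \<in> Hom kleisli_state X Y"
  shows "contextful_to_kleisli U S X (kleisli_to_contextful U S X Y k) = k"
proof (rule PiE_ext)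
  show "contextful_to_kleisli U S X (kleisli_to_contextful U S X Y k)
      \<in> X \<rightarrow>\<^sub>E expS U S (prodS U S Y)"
    using contextful_to_kleisli_hom kleisli_to_contextful_hom[OF X Y k]
    by (simp add: Hom_kleisli_state)
next
  show "k \<in> X \<rightarrow>\<^sub>E expS U S (prodS U S Y)"
    using k by (simp add: Hom_kleisli_state)
next
  fix x assume x: "x \<in> X"
  then have kx: "k x \<in> expS U S (prodS U S Y)"
    using k by (auto simp: Hom_kleisli_state)
  have "contextful_to_kleisli U S X (kleisli_to_contextful U S X Y k) x
      = Fn U (restrict (unFn U S (prodS U S Y) (k x)) S)"
    using X Y x kx
    by (simp add: contextful_to_kleisli_def kleisli_to_contextful_def prodS_Sets cong: restrict_cong)
  then show "contextful_to_kleisli U S X (kleisli_to_contextful U S X Y k) x = k x"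
    using Y kx by (simp add: prodS_Sets)
qed

lemma contextful_to_kleisli_to_contextful:
  assumes X: "X \<in> Sets U" and Y: "Y \<in> Sets U" and Pf: "Pf \<in> Hom contextful_State X Y"
  shows "kleisli_to_contextful U S X Y (contextful_to_kleisli U S X Pf) = Pf"
proof -
  obtain P f where [simp]: "Pf = (P, f)" by (cases Pf)
  have ext: "P \<in> extensional (X \<times> S)" "f \<in> extensional (prodS U S X)"
    using Pf by (auto simp: Hom_contextful_State PiE_iff)
  have "kleisli_to_contextful U S X Y (contextful_to_kleisli U S X Pf)
      = (restrict P (X \<times> S), restrict f (prodS U S X))"
    using X Y contextful_homD[OF Pf[simplified]]
    by (simp add: kleisli_to_contextful_def contextful_to_kleisli_def prodS_Sets
        restrict_pair_eq_iff prodS_restrict_eq_iff)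
  with ext show ?thesis
    by (simp add: extensional_restrict)
qed

lemma contextful_to_kleisli_ident:
  assumes "X \<in> Sets U"
  shows "contextful_to_kleisli U S X (Idt contextful_State X) = Idt kleisli_state X"
  using assms unfolding contextful_to_kleisli_def Idt_contextful_State Idt_kleisli_state
  by (simp cong: restrict_cong)

lemma contextful_State_ident_hom:
  "X \<in> Sets U \<Longrightarrow> Idt contextful_State X \<in> Hom contextful_State X X"
  by (auto simp: Idt_contextful_State Hom_contextful_State)

lemma contextful_State_comp_hom:
  assumes "X \<in> Sets U" "f \<in> Hom contextful_State X Y" "g \<in> Hom contextful_State Y Z"
  shows "Cmp contextful_State X Y Z g f \<in> Hom contextful_State X Z"
proof -
  obtain P f' Q g' where [simp]: "f = (P, f')" "g = (Q, g')" by (cases f; cases g)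
  show ?thesis
    using assms contextful_homD[OF assms(2)[simplified]] contextful_homD[OF assms(3)[simplified]]
    by (simp add: Cmp_contextful_State) (auto simp: Hom_contextful_State elim!: prodS_E)
qed

lemma contextful_to_kleisli_comp:
  assumes X: "X \<in> Sets U" and Y: "Y \<in> Sets U" and Z: "Z \<in> Sets U"
    and f: "f \<in> Hom contextful_State X Y" and g: "g \<in> Hom contextful_State Y Z"
  shows "contextful_to_kleisli U S X (Cmp contextful_State X Y Z g f)
    = Cmp kleisli_state X Y Z (contextful_to_kleisli U S Y g) (contextful_to_kleisli U S X f)"
proof -
  obtain P f' Q g' where [simp]: "f = (P, f')" "g = (Q, g')" by (cases f; cases g)
  note homs = contextful_homD[OF f[simplified]] contextful_homD[OF g[simplified]]
  show ?thesis
    unfolding Cmp_kleisli_state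
    using X Y Z homs f
    by (simp add: Cmp_contextful_State contextful_to_kleisli_def state_monad_def prodS_Sets
        cong: restrict_cong)
qed

end

theorem theorem3p37:
  fixes U :: "('u, 's) universe" and S :: "'s set"
  assumes "state_universe U S"
  shows "isomorphic_categories (contextful_cat (set_cat U) (State U S))
           (kleisli_cat (set_cat U) (state_monad U S))"
proof -
  interpret state_universe U S by (rule assms)
  show ?thesis
    by (rule isomorphic_categories_if_hom_bijections
        [where F = "\<lambda>X _. contextful_to_kleisli U S X" and G = "kleisli_to_contextful U S"])
      (simp_all add: Obj_contextful_State Obj_kleisli_state
        monad.category_kleisli_cat[OF monad_state_monad] contextful_State_ident_hom
        contextful_State_comp_hom contextful_to_kleisli_hom kleisli_to_contextful_hom
        contextful_to_kleisli_to_contextful kleisli_to_contextful_to_kleisli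
        contextful_to_kleisli_ident contextful_to_kleisli_comp)
qed

end
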